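(* Let $m\geq1$ be an integer, $0<\alpha<\beta<\infty$, $\delta>0$ and $0<r_-<r_+<\infty$, and assume $(2m-1)\delta\leq\beta-\alpha$. There exists $C<\infty$, depending only on $m,\alpha,\beta,\delta,r_-$ and $r_+$, such that \[ \|\vartheta-\widetilde\vartheta\|_{\mathbb R^{2m}}\leq C\sup_{r\in[r_-,r_+]}\left|G_{\mu_\vartheta}(r)-G_{\mu_{\widetilde\vartheta}}(r)\right| \] for all $\vartheta,\widetilde\vartheta\in\Theta_{m,\alpha,\beta,\delta}$, where $\|\cdot\|_{\mathbb R^{2m}}$ denotes the Euclidean norm.
   Context: For a finite positive measure $\mu$ supported in a compact subset of $(0,\infty)$, $G_\mu(r)=\int_0^\infty\int_0^\infty\frac{\mu(\mathrm dy)\,\mu(\mathrm dv)}{(r^2+(y+v)^2)^2}$ for $r>0$. For $\vartheta=(a_1,b_1,\ldots,a_m,b_m)\in\mathbb R^{2m}$ with $0<a_1<b_1<\cdots<a_m<b_m<\infty$, put $I(\vartheta)=\bigcup_{j=1}^m[a_j,b_j]$ and $\mu_\vartheta(\mathrm dy)=\mathbf 1_{I(\vartheta)}(y)\,\mathrm dy$. The class $\Theta_{m,\alpha,\beta,\delta}$ consists of all such $\vartheta$ with $\alpha\leq a_1$, $b_m\leq\beta$, $b_j-a_j\geq\delta$ for $1\leq j\leq m$, and $a_{j+1}-b_j\geq\delta$ for $1\leq j<m$. *)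

theory Defs
  imports "HOL-Analysis.Analysis"
begin

text \<open>The iterated integral over \<^term>\<open>{0<..}\<close>; meant for finite Borel measures on the reals
  that are supported in a compact subset of \<^term>\<open>{0<..}\<close>, for which the integrand is bounded.\<close>

definition G :: "real measure \<Rightarrow> real \<Rightarrow> real" where
  "G \<mu> r = (LINT y:{0<..}|\<mu>. (LINT v:{0<..}|\<mu>. 1 / (r\<^sup>2 + (y + v)\<^sup>2)\<^sup>2))"

text \<open>Since \<open>m\<close> is a parameter of the theorem, a vector in \<open>2m\<close>-dimensional Euclidean space is a
  function on the index set \<^term>\<open>{1..2*m}\<close> (extended by \<^const>\<open>undefined\<close>), with coordinates
  listed in the order \<open>a 1, b 1, ..., a m, b m\<close>, so that \<open>a j\<close> has index \<open>2j - 1\<close> and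
  \<open>b j\<close> has index \<open>2j\<close>, for \<open>j \<ge> 1\<close>.\<close>

definition euclid :: "nat \<Rightarrow> (nat \<Rightarrow> real) set" where
  "euclid n = {1..n} \<rightarrow>\<^sub>E (UNIV :: real set)"

definition euclid_dist :: "nat \<Rightarrow> (nat \<Rightarrow> real) \<Rightarrow> (nat \<Rightarrow> real) \<Rightarrow> real" where
  "euclid_dist n x y = L2_set (\<lambda>i. x i - y i) {1..n}"

definition lend :: "(nat \<Rightarrow> real) \<Rightarrow> nat \<Rightarrow> real" where
  "lend \<theta> j = \<theta> (2 * j - 1)"

definition rend :: "(nat \<Rightarrow> real) \<Rightarrow> nat \<Rightarrow> real" where
  "rend \<theta> j = \<theta> (2 * j)"

definition endpoint_vectors :: "nat \<Rightarrow> (nat \<Rightarrow> real) set" where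
  "endpoint_vectors m = {\<theta> \<in> euclid (2 * m).
     0 < lend \<theta> 1 \<and>
     (\<forall>j\<in>{1..m}. lend \<theta> j < rend \<theta> j) \<and>
     (\<forall>j\<in>{1..<m}. rend \<theta> j < lend \<theta> (j + 1))}"

definition interval_union :: "nat \<Rightarrow> (nat \<Rightarrow> real) \<Rightarrow> real set" where
  "interval_union m \<theta> = (\<Union>j\<in>{1..m}. {lend \<theta> j..rend \<theta> j})"

definition interval_measure_of :: "nat \<Rightarrow> (nat \<Rightarrow> real) \<Rightarrow> real measure" where
  "interval_measure_of m \<theta> = density lborel (indicator (interval_union m \<theta>))"

definition Theta :: "nat \<Rightarrow> real \<Rightarrow> real \<Rightarrow> real \<Rightarrow> (nat \<Rightarrow> real) set" where
  "Theta m \<alpha> \<beta> \<delta> = {\<theta> \<in> endpoint_vectors m.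
     \<alpha> \<le> lend \<theta> 1 \<and> rend \<theta> m \<le> \<beta> \<and>
     (\<forall>j\<in>{1..m}. rend \<theta> j - lend \<theta> j \<ge> \<delta>) \<and>
     (\<forall>j\<in>{1..<m}. lend \<theta> (j + 1) - rend \<theta> j \<ge> \<delta>)}"

end

theory Submission
  imports Defs
begin

text \<open>Let \<open>\<nu>\<close> be the signed measure \<open>\<mu> \<theta> - \<mu> \<theta>'\<close>. It equals
  \<open>N * (\<Sum>i. (-1) ^ i * h i * U i)\<close>, where \<open>N\<close> is the distance of \<open>\<theta>\<close> and \<open>\<theta>'\<close>, \<open>h\<close> is the unit vector
  \<open>(\<theta> - \<theta>') / N\<close> and \<open>U i\<close> is the uniform probability on the segment from \<open>\<theta>' i\<close> to \<open>\<theta> i\<close> (a point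
  mass if they coincide). By symmetry of the kernel, \<open>G \<theta> r - G \<theta>' r\<close> is \<open>N\<close> times the integral of
  \<open>1 / (r\<^sup>2 + s\<^sup>2)\<^sup>2\<close> against the convolution of \<open>\<Sum>i. (-1) ^ i * h i * U i\<close> with \<open>\<mu> \<theta> + \<mu> \<theta>'\<close>. This factor
  is continuous in \<open>(\<theta>, \<theta>', h)\<close> on a compact set that allows \<open>\<theta> = \<theta>'\<close> with an arbitrary unit vector
  \<open>h\<close>, so it suffices that it does not vanish for all \<open>r\<close> in the interval at once. If it did, then
  the convolution would be zero, because the kernels span a dense subspace of the continuous
  functions on a compact subset of the half-line (differentiate in \<open>r\<^sup>2\<close> and apply Weierstrass). Testing
  with exponentials turns the convolution into a product and the positive factor cancels; finally
  the measures \<open>U i\<close> are linearly independent, since the right endpoints of the segments increase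
  strictly in \<open>i\<close>.\<close>

section \<open>Density of the kernels\<close>

text \<open>The relation between \<open>a\<close> and \<open>b\<close> is that of
  \<open>a = 1 / (x + s^2)\<close> and \<open>b = 1 / (x + h + s^2)\<close>. For these the bound is
  a first-order Taylor estimate in \<open>x\<close> for the \<open>n\<close>-th power, with
  derivative \<open>- n * a ^ (n + 1)\<close> and a remainder that is uniform in \<open>s\<close>
  once \<open>U\<close> is. The induction splits one factor \<open>b\<close> off the power.\<close>

lemma power_remainder_bound:
  fixes a b h U :: real
  assumes "0 \<le> a" "a \<le> U" "0 \<le> b" "b \<le> U" "b - a = - h * a * b"
  shows "\<bar>b ^ n - a ^ n + real n * h * a ^ Suc n\<bar> \<le> (real n)\<^sup>2 * U ^ (n + 2) * h\<^sup>2"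
proof (induction n)
  case 0
  then show ?case by simp
next
  case (Suc n)
  have U: "0 \<le> U" using assms by linarith
  let ?R = "b ^ n - a ^ n + real n * h * a ^ Suc n"
  have "b ^ Suc n - a ^ Suc n + real (Suc n) * h * a ^ Suc (Suc n)
      = b * ?R + (b - a) * a ^ n - real n * h * b * a ^ Suc n + real (Suc n) * h * a ^ Suc (Suc n)"
    by (simp add: algebra_simps)
  also have "\<dots> = b * ?R - real (Suc n) * h * a ^ Suc n * (b - a)"
  proof -
    have "(b - a) * a ^ n = - h * b * a ^ Suc n" using assms(5) by simp
    then show ?thesis by (simp add: algebra_simps)
  qed
  also have "\<dots> = b * ?R + real (Suc n) * (h\<^sup>2 * (a ^ (n + 2) * b))"
    unfolding assms(5) by (simp add: algebra_simps power2_eq_square)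
  finally have eq: "b ^ Suc n - a ^ Suc n + real (Suc n) * h * a ^ Suc (Suc n)
      = b * ?R + real (Suc n) * (h\<^sup>2 * (a ^ (n + 2) * b))" .
  have "\<bar>b * ?R\<bar> \<le> U * ((real n)\<^sup>2 * U ^ (n + 2) * h\<^sup>2)"
    unfolding abs_mult using Suc.IH assms U by (intro mult_mono) auto
  moreover have "a ^ (n + 2) * b \<le> U ^ (n + 2) * U"
    using assms U by (intro mult_mono power_mono) auto
  then have "\<bar>real (Suc n) * (h\<^sup>2 * (a ^ (n + 2) * b))\<bar> \<le> real (Suc n) * (h\<^sup>2 * (U ^ (n + 2) * U))"
    using assms by (simp add: abs_mult mult_left_mono)
  ultimately have "\<bar>b * ?R + real (Suc n) * (h\<^sup>2 * (a ^ (n + 2) * b))\<bar>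
      \<le> ((real n)\<^sup>2 + real (Suc n)) * U ^ (Suc n + 2) * h\<^sup>2"
    by (intro order_trans[OF abs_triangle_ineq]) (simp add: algebra_simps)
  \<comment> \<open>The constant \<open>n^2\<close> reproduces itself because
    \<open>n^2 + (n + 1)\<close> is at most \<open>(n + 1)^2\<close>.\<close>
  also have "\<dots> \<le> (real (Suc n))\<^sup>2 * U ^ (Suc n + 2) * h\<^sup>2"
    using U by (intro mult_right_mono) (auto simp: power2_eq_square algebra_simps)
  finally show ?case unfolding eq .
qed

text \<open>Stands for integration against a finite signed measure on \<open>{A..B}\<close>: the
  functions live on the whole line, but \<open>bound\<close> looks only at their values on
  \<open>{A..B}\<close>. Linearity is asked for continuous functions only, where the integrals to
  which it is applied behave well.\<close>

locale bounded_functional =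
  fixes \<Lambda> :: "(real \<Rightarrow> real) \<Rightarrow> real" and A B M :: real
  assumes add: "\<And>f g. continuous_on UNIV f \<Longrightarrow> continuous_on UNIV g \<Longrightarrow>
      \<Lambda> (\<lambda>s. f s + g s) = \<Lambda> f + \<Lambda> g"
    and scale: "\<And>f c. continuous_on UNIV f \<Longrightarrow> \<Lambda> (\<lambda>s. c * f s) = c * \<Lambda> f"
    and bound: "\<And>f e. continuous_on UNIV f \<Longrightarrow> (\<And>s. s \<in> {A..B} \<Longrightarrow> \<bar>f s\<bar> \<le> e) \<Longrightarrow> \<bar>\<Lambda> f\<bar> \<le> M * e"
begin

lemma diff:
  assumes "continuous_on UNIV f" "continuous_on UNIV g"
  shows "\<Lambda> (\<lambda>s. f s - g s) = \<Lambda> f - \<Lambda> g"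
  using add[OF assms(1), of "\<lambda>s. (-1) * g s"] scale[OF assms(2), of "-1"] assms
  by (auto intro!: continuous_intros)

lemma zero: "\<Lambda> (\<lambda>s. 0) = 0"
  using bound[of "\<lambda>s. 0" 0] by simp

lemma sum:
  assumes "finite I" "\<And>i. i \<in> I \<Longrightarrow> continuous_on UNIV (f i)"
  shows "\<Lambda> (\<lambda>s. \<Sum>i\<in>I. f i s) = (\<Sum>i\<in>I. \<Lambda> (f i))"
  using assms
proof (induction I rule: finite_induct)
  case (insert i I)
  then show ?case
    using add[of "f i" "\<lambda>s. \<Sum>i\<in>I. f i s"] by (auto intro!: continuous_intros)
qed (simp add: zero)

text \<open>Up to a nonzero factor, differentiating \<open>1 / (x + s^2) ^ N\<close> in
  \<open>x\<close> raises the exponent by one. A function of \<open>x\<close> that is zero on an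
  open interval has derivative zero there, so induction reaches every exponent from 2 on. The point
  \<open>x\<close> must stay arbitrary, since the step also uses the hypothesis at
  \<open>x + h\<close>.\<close>

lemma vanishes_on_powers:
  assumes "0 < x1"
    and vanish: "\<And>x. x \<in> {x1<..<x2} \<Longrightarrow> \<Lambda> (\<lambda>s. (1 / (x + s\<^sup>2))\<^sup>2) = 0"
    and "x \<in> {x1<..<x2}"
  shows "\<Lambda> (\<lambda>s. (1 / (x + s\<^sup>2)) ^ (n + 2)) = 0"
  using assms(3)
proof (induction n arbitrary: x)
  case 0
  then show ?case using vanish[of x] by (simp del: power_divide power_one_over add: numeral_2_eq_2)
next
  case (Suc n)
  define N where "N = n + 2"
  define C where "C = (real N)\<^sup>2 * (1 / x1) ^ (N + 2)"
  let ?u = "\<lambda>x s::real. 1 / (x + s\<^sup>2)"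
  have cont: "continuous_on UNIV (\<lambda>s. ?u y s ^ k)" if "y > 0" for y k
  proof -
    have "y + s\<^sup>2 \<noteq> 0" for s using that zero_le_power2[of s] by linarith
    then show ?thesis by (intro continuous_intros) auto
  qed
  have x: "0 < x" using Suc.prems \<open>0 < x1\<close> by auto
  \<comment> \<open>In the expansion from \<open>x\<close> to \<open>x + h\<close> both values at
    exponent \<open>N\<close> vanish by induction. The linear term is then bounded by the remainder,
    and one factor \<open>h\<close> cancels.\<close>
  have le: "\<bar>real N * \<Lambda> (\<lambda>s. ?u x s ^ Suc N)\<bar> \<le> M * (C * h)" if h: "h \<in> {0<..<x2 - x}" for h
  proof -
    let ?f = "\<lambda>s. ?u (x + h) s ^ N - ?u x s ^ N + real N * h * ?u x s ^ Suc N"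
    have xh: "x + h \<in> {x1<..<x2}" "x + h > 0" using h Suc.prems x by auto
    have c: "continuous_on UNIV ?f"
      using x xh by (intro continuous_intros cont) auto
    have "\<bar>?f s\<bar> \<le> C * h\<^sup>2" for s
    proof -
      have p: "x + s\<^sup>2 > 0" "x + h + s\<^sup>2 > 0"
        using x xh zero_le_power2[of s] by linarith+
      have q: "x1 \<le> x + s\<^sup>2" "x1 \<le> x + h + s\<^sup>2"
        using Suc.prems xh(1) zero_le_power2[of s] unfolding greaterThanLessThan_iff by linarith+
      show ?thesis
        unfolding C_def
      proof (rule power_remainder_bound)
        show "?u x s \<le> 1 / x1" "?u (x + h) s \<le> 1 / x1"
          using q \<open>0 < x1\<close> by (intro divide_left_mono; simp)+
        show "?u (x + h) s - ?u x s = - h * ?u x s * ?u (x + h) s"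
          using p by (simp add: divide_simps)
      qed (use p in auto)
    qed
    then have "\<bar>\<Lambda> ?f\<bar> \<le> M * (C * h\<^sup>2)"
      using bound[OF c] by blast
    also have "\<Lambda> ?f = \<Lambda> (\<lambda>s. ?u (x + h) s ^ N) - \<Lambda> (\<lambda>s. ?u x s ^ N)
        + real N * h * \<Lambda> (\<lambda>s. ?u x s ^ Suc N)"
      using x xh by (simp only: add diff scale cont continuous_on_diff continuous_on_mult_left)
    also have "\<dots> = h * (real N * \<Lambda> (\<lambda>s. ?u x s ^ Suc N))"
      using Suc.IH[of x] Suc.IH[of "x + h"] xh Suc.prems unfolding N_def by simp
    finally have "h * \<bar>real N * \<Lambda> (\<lambda>s. ?u x s ^ Suc N)\<bar> \<le> h * (M * (C * h))"
      using h by (simp add: abs_mult power2_eq_square mult_ac)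
    then show ?thesis using h by simp
  qed
  \<comment> \<open>Letting \<open>h\<close> tend to 0 from the right removes the remainder.\<close>
  have "((\<lambda>h. M * (C * h)) \<longlongrightarrow> M * (C * 0)) (at_right 0)"
    by (intro tendsto_intros)
  moreover have "\<forall>\<^sub>F h in at_right 0. \<bar>real N * \<Lambda> (\<lambda>s. ?u x s ^ Suc N)\<bar> \<le> M * (C * h)"
    using Suc.prems le by (intro eventually_at_rightI[of 0 "x2 - x"]) auto
  ultimately have "\<bar>real N * \<Lambda> (\<lambda>s. ?u x s ^ Suc N)\<bar> \<le> M * (C * 0)"
    by (intro tendsto_lowerbound[of _ _ "at_right 0"]) auto
  then show ?case by (simp add: N_def)
qed

text \<open>At one fixed \<open>x\<close> between the squares of \<open>r1\<close> and
  \<open>r2\<close>, all powers of \<open>u s = 1 / (x + s^2)\<close> from the second on are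
  annihilated. Since \<open>0 \<le> A\<close>, the map \<open>u\<close> is injective on
  \<open>{A..B}\<close>, so a continuous \<open>g\<close> agrees there with \<open>u^2\<close> times
  a continuous function of \<open>u\<close>. The latter is approximated uniformly by polynomials,
  and the bound carries the approximation over to the functional.\<close>

lemma vanishes:
  assumes "0 \<le> A" "0 < r1" "r1 < r2"
    and kernel: "\<And>r. r \<in> {r1..r2} \<Longrightarrow> \<Lambda> (\<lambda>s. 1 / (r\<^sup>2 + s\<^sup>2)\<^sup>2) = 0"
    and g: "continuous_on UNIV g"
  shows "\<Lambda> g = 0"
proof -
  have sq: "r1\<^sup>2 < r2\<^sup>2" "0 < r1\<^sup>2" using assms by (auto intro!: power_strict_mono)
  obtain x where x: "r1\<^sup>2 < x" "x < r2\<^sup>2" using dense[OF sq(1)] by blast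
  have x0: "0 < x" using x sq by linarith
  define u where "u s = 1 / (x + s\<^sup>2)" for s :: real
  have upos: "0 < u s" "u s \<le> 1 / x" for s
    unfolding u_def using x0 zero_le_power2[of s]
    by (auto intro!: divide_pos_pos divide_left_mono add_pos_nonneg mult_pos_pos)
  have ucont: "continuous_on S u" for S
  proof -
    have "x + s\<^sup>2 \<noteq> 0" for s using x0 zero_le_power2[of s] by linarith
    then show ?thesis unfolding u_def by (intro continuous_intros) auto
  qed
  have pow: "\<Lambda> (\<lambda>s. u s ^ (n + 2)) = 0" for n
    unfolding u_def
  proof (rule vanishes_on_powers[of "r1\<^sup>2" "r2\<^sup>2"])
    fix y assume y: "y \<in> {r1\<^sup>2<..<r2\<^sup>2}"
    then have "0 \<le> y" using sq(2) unfolding greaterThanLessThan_iff by linarith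
    then have "sqrt y \<in> {r1..r2}" "(sqrt y)\<^sup>2 = y"
      using y assms by (auto intro: real_le_rsqrt real_le_lsqrt)
    then show "\<Lambda> (\<lambda>s. (1 / (y + s\<^sup>2))\<^sup>2) = 0"
      using kernel[of "sqrt y"] by (simp add: power_one_over)
  qed (use sq x in auto)
  \<comment> \<open>The square root inverts \<open>u\<close> on nonnegative arguments. The division
    by \<open>w^2\<close> reserves a factor \<open>u^2\<close>, because the exponents 0 and 1 are
    not among the annihilated powers.\<close>
  define \<phi> where "\<phi> w = g (sqrt (1 / w - x)) / w\<^sup>2" for w
  have \<phi>: "u s ^ 2 * \<phi> (u s) = g s" if "s \<in> {A..B}" for s
    using upos(1)[of s] that \<open>0 \<le> A\<close> by (simp add: \<phi>_def u_def)
  have "continuous_on (u ` {A..B}) \<phi>"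
    unfolding \<phi>_def using upos(1)
    by (intro continuous_intros continuous_on_compose2[OF g]) (auto simp: less_imp_neq[symmetric])
  moreover have "compact (u ` {A..B})"
    using ucont by (intro compact_continuous_image) auto
  ultimately have "\<bar>\<Lambda> g\<bar> \<le> M * ((1 / x)\<^sup>2 * e)" if "e > 0" for e
  proof -
    obtain p where p: "real_polynomial_function p"
      "\<And>w. w \<in> u ` {A..B} \<Longrightarrow> \<bar>\<phi> w - p w\<bar> < e"
      using Stone_Weierstrass_real_polynomial_function \<open>continuous_on _ \<phi>\<close> \<open>compact (u ` _)\<close> \<open>e > 0\<close>
      by metis
    obtain c n where c: "p = (\<lambda>w. \<Sum>i\<le>n. c i * w ^ i)"
      using p(1) real_polynomial_function_iff_sum by blast
    have q: "(\<lambda>s. u s ^ 2 * p (u s)) = (\<lambda>s. \<Sum>i\<le>n. c i * u s ^ (i + 2))"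
      unfolding c by (simp add: sum_distrib_left power_add power2_eq_square mult_ac)
    have "\<Lambda> (\<lambda>s. u s ^ 2 * p (u s)) = (\<Sum>i\<le>n. c i * \<Lambda> (\<lambda>s. u s ^ (i + 2)))"
      unfolding q by (subst sum) (auto intro!: continuous_intros ucont scale sum.cong)
    also have "\<dots> = 0" using pow by simp
    finally have 0: "\<Lambda> (\<lambda>s. u s ^ 2 * p (u s)) = 0" .
    have pc: "continuous_on UNIV (\<lambda>s. u s ^ 2 * p (u s))"
      unfolding c by (intro continuous_intros ucont)
    have "\<bar>\<Lambda> (\<lambda>s. g s - u s ^ 2 * p (u s))\<bar> \<le> M * ((1 / x)\<^sup>2 * e)"
    proof (rule bound)
      fix s assume s: "s \<in> {A..B}"
      have "g s - u s ^ 2 * p (u s) = u s ^ 2 * (\<phi> (u s) - p (u s))"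
        using \<phi>[OF s] by (simp add: algebra_simps)
      moreover have "\<bar>\<phi> (u s) - p (u s)\<bar> \<le> e" using p(2) s by (simp add: less_imp_le)
      ultimately show "\<bar>g s - u s ^ 2 * p (u s)\<bar> \<le> (1 / x)\<^sup>2 * e"
        using upos[of s] by (simp only: abs_mult) (intro mult_mono, auto intro!: power_mono)
    qed (intro continuous_intros g pc)
    then show ?thesis using 0 diff[OF g pc] by simp
  qed
  then have "\<forall>\<^sub>F e in at_right 0. \<bar>\<Lambda> g\<bar> \<le> M * ((1 / x)\<^sup>2 * e)"
    by (intro eventually_at_rightI[of 0 1]) auto
  moreover have "((\<lambda>e. M * ((1 / x)\<^sup>2 * e)) \<longlongrightarrow> M * ((1 / x)\<^sup>2 * 0)) (at_right 0)"
    by (intro tendsto_intros)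
  ultimately have "\<bar>\<Lambda> g\<bar> \<le> M * ((1 / x)\<^sup>2 * 0)"
    by (intro tendsto_lowerbound[of _ _ "at_right 0"]) auto
  then show ?thesis by simp
qed

end

section \<open>Endpoint vectors and integrals over interval unions\<close>

text \<open>Treats left and right endpoints alike: an interval and a gap both become a step of at
  least \<open>\<delta>\<close> between consecutive coordinates. All inequalities are non-strict,
  which makes the set closed.\<close>

definition gap_vectors :: "nat \<Rightarrow> real \<Rightarrow> real \<Rightarrow> real \<Rightarrow> (nat \<Rightarrow> real) set" where
  "gap_vectors n \<alpha> \<beta> \<delta> =
    {\<theta> \<in> euclid n. \<alpha> \<le> \<theta> 1 \<and> \<theta> n \<le> \<beta> \<and> (\<forall>i\<in>{1..<n}. \<theta> i + \<delta> \<le> \<theta> (Suc i))}"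

text \<open>The step from an even index to the next one is a gap between intervals, and the step
  from an odd index is the length of an interval.\<close>

lemma Theta_subset_gap_vectors: "Theta m \<alpha> \<beta> \<delta> \<subseteq> gap_vectors (2 * m) \<alpha> \<beta> \<delta>"
proof
  fix \<theta> assume \<theta>: "\<theta> \<in> Theta m \<alpha> \<beta> \<delta>"
  have "\<theta> i + \<delta> \<le> \<theta> (Suc i)" if i: "i \<in> {1..<2 * m}" for i
  proof (cases "even i")
    case True
    then obtain j where "i = 2 * j" by blast
    then have "j \<in> {1..<m}" "rend \<theta> j = \<theta> i" "lend \<theta> (j + 1) = \<theta> (Suc i)"
      using i by (auto simp: rend_def lend_def)
    then show ?thesis using \<theta> by (force simp: Theta_def)
  next
    case False
    then obtain j where "i = 2 * j + 1" by (blast elim: oddE)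
    then have "j + 1 \<in> {1..m}" "lend \<theta> (j + 1) = \<theta> i" "rend \<theta> (j + 1) = \<theta> (Suc i)"
      using i by (auto simp: rend_def lend_def)
    then show ?thesis using \<theta> by (force simp: Theta_def)
  qed
  then show "\<theta> \<in> gap_vectors (2 * m) \<alpha> \<beta> \<delta>"
    using \<theta> by (auto simp: gap_vectors_def Theta_def endpoint_vectors_def lend_def rend_def)
qed

lemma gap_vectors_gap:
  assumes "\<theta> \<in> gap_vectors n \<alpha> \<beta> \<delta>" "0 \<le> \<delta>" "1 \<le> i" "i < j" "j \<le> n"
  shows "\<theta> i + \<delta> \<le> \<theta> j"
  using \<open>i < j\<close> \<open>j \<le> n\<close>
proof (induction j)
  case (Suc j)
  then have "\<theta> j + \<delta> \<le> \<theta> (Suc j)"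
    using assms by (auto simp: gap_vectors_def)
  then show ?case
    using Suc \<open>0 \<le> \<delta>\<close> by (cases "i = j") auto
qed simp

lemma gap_vectors_range:
  assumes "\<theta> \<in> gap_vectors n \<alpha> \<beta> \<delta>" "0 \<le> \<delta>" "i \<in> {1..n}"
  shows "\<theta> i \<in> {\<alpha>..\<beta>}"
proof -
  have "\<theta> 1 \<le> \<theta> i" "\<theta> i \<le> \<theta> n"
    using gap_vectors_gap[OF assms(1,2), of 1 i] gap_vectors_gap[OF assms(1,2), of i n] assms
    by (cases "i = 1"; cases "i = n"; force)+
  then show ?thesis using assms(1) by (auto simp: gap_vectors_def)
qed

lemma compact_PiE_UNIV:
  assumes "\<And>i. compact (S i)"
  shows "compact (PiE UNIV S)"
  using compactin_PiE[of "\<lambda>_. euclidean" UNIV S] assms by (simp add: euclidean_product_topology)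

lemma compact_gap_vectors:
  assumes "0 \<le> \<delta>"
  shows "compact (gap_vectors n \<alpha> \<beta> \<delta>)"
proof -
  \<comment> \<open>Coordinates outside \<open>{1..n}\<close> are pinned to the single value
    \<open>undefined\<close>, so Tychonoff's theorem applies on the whole index type.\<close>
  let ?S = "PiE UNIV (\<lambda>i. if i \<in> {1..n} then {\<alpha>..\<beta>} else {undefined :: real})"
  let ?C = "{\<theta> :: nat \<Rightarrow> real. \<alpha> \<le> \<theta> 1} \<inter> {\<theta>. \<theta> n \<le> \<beta>} \<inter> (\<Inter>i\<in>{1..<n}. {\<theta>. \<theta> i + \<delta> \<le> \<theta> (Suc i)})"
  have "gap_vectors n \<alpha> \<beta> \<delta> = ?S \<inter> ?C"
  proof (intro set_eqI iffI)
    fix \<theta> assume \<theta>: "\<theta> \<in> gap_vectors n \<alpha> \<beta> \<delta>"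
    then have "\<theta> \<in> ?S" using gap_vectors_range[OF \<theta> assms]
      by (auto simp: gap_vectors_def euclid_def PiE_iff extensional_def)
    then show "\<theta> \<in> ?S \<inter> ?C" using \<theta> by (auto simp: gap_vectors_def)
  next
    fix \<theta> assume \<theta>: "\<theta> \<in> ?S \<inter> ?C"
    have "\<theta> i = undefined" if "i \<notin> {1..n}" for i
      using PiE_mem[of \<theta> UNIV _ i] \<theta> that by (auto simp only: split: if_splits)
    then show "\<theta> \<in> gap_vectors n \<alpha> \<beta> \<delta>" using \<theta>
      by (auto simp: gap_vectors_def euclid_def extensional_def)
  qed
  moreover have "compact ?S" by (intro compact_PiE_UNIV) auto
  moreover have "closed ?C"
    by (intro closed_Int closed_INT ballI closed_Collect_le continuous_on_add
      continuous_on_const continuous_on_product_coordinates)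
  ultimately show ?thesis by (simp add: compact_Int_closed)
qed

section \<open>Integrals over interval unions as alternating endpoint sums\<close>

definition union_integral :: "nat \<Rightarrow> (nat \<Rightarrow> real) \<Rightarrow> (real \<Rightarrow> real) \<Rightarrow> real" where
  "union_integral m \<theta> f = (\<Sum>j=1..m. integral {lend \<theta> j..rend \<theta> j} f)"

lemma gap_vectors_lend_rend:
  assumes "\<theta> \<in> gap_vectors (2 * m) \<alpha> \<beta> \<delta>" "0 \<le> \<delta>" "j \<in> {1..m}"
  shows "lend \<theta> j + \<delta> \<le> rend \<theta> j" "\<alpha> \<le> lend \<theta> j" "rend \<theta> j \<le> \<beta>"
proof -
  have j: "1 \<le> 2 * j - 1" "2 * j - 1 < 2 * j" "2 * j - 1 \<in> {1..2 * m}" "2 * j \<in> {1..2 * m}"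
    using assms(3) by auto
  show "lend \<theta> j + \<delta> \<le> rend \<theta> j" "\<alpha> \<le> lend \<theta> j" "rend \<theta> j \<le> \<beta>"
    using gap_vectors_gap[OF assms(1,2) j(1,2)] gap_vectors_range[OF assms(1,2) j(3)]
      gap_vectors_range[OF assms(1,2) j(4)] j(4)
    by (auto simp: lend_def rend_def)
qed

text \<open>By \<open>0 < \<alpha>\<close> the union lies in the positive half-line, and by
  \<open>0 < \<delta>\<close> its intervals are disjoint, so the integral against the density splits
  into one gauge integral per interval. This replaces the measures in \<open>G\<close> by integrals
  that antiderivatives evaluate.\<close>

lemma LINT_interval_measure_of:
  assumes \<theta>: "\<theta> \<in> gap_vectors (2 * m) \<alpha> \<beta> \<delta>" and "0 < \<alpha>" "0 < \<delta>"
    and f: "continuous_on UNIV f"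
  shows "(LINT y:{0<..}|interval_measure_of m \<theta>. f y) = union_integral m \<theta> f"
proof -
  let ?A = "\<lambda>j. {lend \<theta> j..rend \<theta> j}"
  let ?I = "interval_union m \<theta>"
  have \<delta>: "0 \<le> \<delta>" using \<open>0 < \<delta>\<close> by simp
  note lr = gap_vectors_lend_rend[OF \<theta> \<delta>]
  have meas: "?I \<in> sets lborel" unfolding interval_union_def by auto
  have fm: "f \<in> borel_measurable borel" using f by (rule borel_measurable_continuous_onI)
  have pos: "x > 0" if "x \<in> ?I" for x
    using that lr \<open>0 < \<alpha>\<close> unfolding interval_union_def by force
  have dens: "interval_measure_of m \<theta> = density lborel (\<lambda>x. ennreal (indicator ?I x))"
    unfolding interval_measure_of_def by (simp add: ennreal_indicator)
  have "(LINT y:{0<..}|interval_measure_of m \<theta>. f y)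
      = (LINT x|lborel. indicator ?I x *\<^sub>R (indicator {0<..} x *\<^sub>R f x))"
    unfolding set_lebesgue_integral_def dens
    by (rule integral_density) (use meas fm in auto)
  also have "\<dots> = (LINT x:(\<Union>j\<in>{1..m}. ?A j)|lborel. f x)"
    unfolding set_lebesgue_integral_def interval_union_def[symmetric]
    using pos by (intro Bochner_Integration.integral_cong) (auto simp: indicator_def)
  also have "\<dots> = (\<Sum>j\<in>{1..m}. LINT x:?A j|lborel. f x)"
  proof (rule set_integral_finite_Union)
    have "disjnt (?A i) (?A j)" if "i \<in> {1..m}" "j \<in> {1..m}" "i < j" for i j
    proof -
      have "1 \<le> 2 * i" "2 * i < 2 * j - 1" "2 * j - 1 \<le> 2 * m" using that by auto
      then have "\<theta> (2 * i) + \<delta> \<le> \<theta> (2 * j - 1)" by (rule gap_vectors_gap[OF \<theta> \<delta>])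
      then show ?thesis using \<open>0 < \<delta>\<close> by (auto simp: lend_def rend_def disjnt_def)
    qed
    then show "disjoint_family_on ?A {1..m}"
      unfolding disjoint_family_on_def disjnt_def[symmetric]
      by (auto simp: neq_iff disjnt_sym)
    show "set_integrable lborel (?A j) f" for j
      by (rule borel_integrable_atLeastAtMost') (rule continuous_on_subset[OF f], simp)
  qed auto
  also have "\<dots> = union_integral m \<theta> f"
    unfolding union_integral_def
    by (intro sum.cong set_borel_integral_eq_integral borel_integrable_atLeastAtMost'
        continuous_on_subset[OF f]) auto
  finally show ?thesis .
qed

lemma antiderivative_exists:
  assumes "continuous_on UNIV (f :: real \<Rightarrow> real)"
  obtains F where "\<And>x. (F has_real_derivative f x) (at x)"
  using einterval_antiderivative[of "-\<infinity>" \<infinity> f] assms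
  by (auto simp: continuous_on_eq_continuous_at has_real_derivative_iff_has_vector_derivative)

lemma has_real_derivative_continuous_on:
  "(\<And>x. (F has_real_derivative f x) (at x)) \<Longrightarrow> continuous_on UNIV F"
  by (meson DERIV_isCont continuous_at_imp_continuous_on)

lemma alternating_sum_pairs:
  fixes g :: "nat \<Rightarrow> 'a :: comm_ring_1"
  shows "(\<Sum>j=1..m. g (2 * j) - g (2 * j - 1)) = (\<Sum>i=1..2 * m. (-1) ^ i * g i)"
  by (induction m) (auto simp: algebra_simps)

lemma integral_antiderivative:
  assumes "\<And>x. (F has_real_derivative f x) (at x)" "a \<le> b"
  shows "integral {a..b} f = F b - F a"
  using assms
  by (intro integral_unique fundamental_theorem_of_calculus)
    (auto intro: has_vector_derivative_at_within simp: has_real_derivative_iff_has_vector_derivative)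

text \<open>Right endpoints have even index and enter with sign plus, left endpoints have odd index
  and enter with sign minus.\<close>

lemma union_integral_antiderivative:
  assumes F: "\<And>x. (F has_real_derivative f x) (at x)"
    and \<theta>: "\<theta> \<in> gap_vectors (2 * m) \<alpha> \<beta> \<delta>" "0 \<le> \<delta>"
  shows "union_integral m \<theta> f = (\<Sum>i=1..2 * m. (-1) ^ i * F (\<theta> i))"
proof -
  have "lend \<theta> j \<le> rend \<theta> j" if "j \<in> {1..m}" for j
    using gap_vectors_lend_rend(1)[OF \<theta> that] \<open>0 \<le> \<delta>\<close> by simp
  then have "union_integral m \<theta> f = (\<Sum>j=1..m. F (\<theta> (2 * j)) - F (\<theta> (2 * j - 1)))"
    unfolding union_integral_def lend_def rend_def
    by (intro sum.cong integral_antiderivative F) auto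
  then show ?thesis using alternating_sum_pairs[of "\<lambda>i. F (\<theta> i)" m] by simp
qed

lemma union_integral_shift:
  assumes F: "\<And>x. (F has_real_derivative f x) (at x)"
    and \<theta>: "\<theta> \<in> gap_vectors (2 * m) \<alpha> \<beta> \<delta>" "0 \<le> \<delta>"
  shows "union_integral m \<theta> (\<lambda>v. f (y + v)) = (\<Sum>i=1..2 * m. (-1) ^ i * F (y + \<theta> i))"
proof (rule union_integral_antiderivative[OF _ \<theta>])
  show "((\<lambda>v. F (y + v)) has_real_derivative f (y + x)) (at x)" for x
    using F[of "y + x"] by (simp add: DERIV_shift add.commute)
qed

lemma continuous_on_union_integral_shift:
  assumes f: "continuous_on UNIV f"
    and \<theta>: "\<theta> \<in> gap_vectors (2 * m) \<alpha> \<beta> \<delta>" "0 \<le> \<delta>"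
  shows "continuous_on UNIV (\<lambda>y. union_integral m \<theta> (\<lambda>v. f (y + v)))"
proof -
  obtain F where F: "\<And>x. (F has_real_derivative f x) (at x)"
    using antiderivative_exists[OF f] by blast
  show ?thesis
    unfolding union_integral_shift[OF F \<theta>]
    by (intro continuous_intros continuous_on_compose2[OF has_real_derivative_continuous_on[OF F]]) auto
qed

lemma union_integral_add:
  assumes "continuous_on UNIV f" "continuous_on UNIV g"
  shows "union_integral m \<theta> (\<lambda>x. f x + g x) = union_integral m \<theta> f + union_integral m \<theta> g"
  unfolding union_integral_def sum.distrib[symmetric]
  by (intro sum.cong Henstock_Kurzweil_Integration.integral_add integrable_continuous_interval
      assms[THEN continuous_on_subset]) auto

lemma union_integral_scale: "union_integral m \<theta> (\<lambda>x. c * f x) = c * union_integral m \<theta> f"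
  unfolding union_integral_def by (simp add: sum_distrib_left)

lemma union_integral_bound:
  assumes \<theta>: "\<theta> \<in> gap_vectors (2 * m) \<alpha> \<beta> \<delta>" "0 \<le> \<delta>" and "0 \<le> \<alpha>"
    and f: "continuous_on UNIV f" "\<And>x. x \<in> {\<alpha>..\<beta>} \<Longrightarrow> \<bar>f x\<bar> \<le> e"
  shows "\<bar>union_integral m \<theta> f\<bar> \<le> real m * \<beta> * e"
proof -
  have "\<bar>integral {lend \<theta> j..rend \<theta> j} f\<bar> \<le> \<beta> * e" if j: "j \<in> {1..m}" for j
  proof -
    note lr = gap_vectors_lend_rend[OF \<theta> j]
    have le: "lend \<theta> j \<le> rend \<theta> j" using lr \<open>0 \<le> \<delta>\<close> by simp
    have "\<bar>f (lend \<theta> j)\<bar> \<le> e" using lr le by (intro f) auto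
    then have e: "0 \<le> e" by linarith
    have "norm (integral {lend \<theta> j..rend \<theta> j} f) \<le> e * (rend \<theta> j - lend \<theta> j)"
      using le lr by (intro integral_bound continuous_on_subset[OF f(1)]) (auto intro!: f(2))
    also have "\<dots> \<le> e * \<beta>" using lr \<open>0 \<le> \<alpha>\<close> e by (intro mult_left_mono) auto
    finally show ?thesis by (simp add: mult.commute)
  qed
  then have "\<bar>union_integral m \<theta> f\<bar> \<le> (\<Sum>j=1..m. \<beta> * e)"
    unfolding union_integral_def by (intro order_trans[OF sum_abs] sum_mono) auto
  then show ?thesis by simp
qed

lemma union_integral_pos:
  assumes \<theta>: "\<theta> \<in> gap_vectors (2 * m) \<alpha> \<beta> \<delta>" "0 < \<delta>" and "1 \<le> m"
    and f: "continuous_on UNIV f" "\<And>x. 0 < f x"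
  shows "0 < union_integral m \<theta> f"
proof -
  obtain F where F: "\<And>x. (F has_real_derivative f x) (at x)"
    using antiderivative_exists[OF f(1)] by blast
  have "0 < integral {lend \<theta> j..rend \<theta> j} f" if j: "j \<in> {1..m}" for j
  proof -
    have "lend \<theta> j < rend \<theta> j" using gap_vectors_lend_rend[OF \<theta>(1) _ j] \<open>0 < \<delta>\<close> by simp
    moreover from this have "F (lend \<theta> j) < F (rend \<theta> j)"
      by (rule DERIV_pos_imp_increasing) (use F f(2) in blast)
    ultimately show ?thesis using integral_antiderivative[OF F] by simp
  qed
  then show ?thesis unfolding union_integral_def using \<open>1 \<le> m\<close> by (intro sum_pos) auto
qed

text \<open>Fubini for a kernel in \<open>y + v\<close>, obtained without product measures: with a
  second antiderivative \<open>H\<close>, both sides are the same signed double sum of values of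
  \<open>H\<close> at sums of endpoints.\<close>

lemma union_integral_swap:
  assumes f: "continuous_on UNIV f" and "0 \<le> \<delta>"
    and \<theta>: "\<theta> \<in> gap_vectors (2 * m) \<alpha> \<beta> \<delta>" and \<theta>': "\<theta>' \<in> gap_vectors (2 * m) \<alpha> \<beta> \<delta>"
  shows "union_integral m \<theta> (\<lambda>y. union_integral m \<theta>' (\<lambda>v. f (y + v)))
       = union_integral m \<theta>' (\<lambda>y. union_integral m \<theta> (\<lambda>v. f (y + v)))"
proof -
  obtain F where F: "\<And>x. (F has_real_derivative f x) (at x)"
    using antiderivative_exists[OF f] by blast
  obtain H where H: "\<And>x. (H has_real_derivative F x) (at x)"
    using antiderivative_exists[OF has_real_derivative_continuous_on[OF F]] by blast
  have eq: "union_integral m \<eta> (\<lambda>y. union_integral m \<eta>' (\<lambda>v. f (y + v)))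
      = (\<Sum>i=1..2*m. \<Sum>j=1..2*m. (-1) ^ i * (-1) ^ j * H (\<eta> i + \<eta>' j))"
    if "\<eta> \<in> gap_vectors (2 * m) \<alpha> \<beta> \<delta>" "\<eta>' \<in> gap_vectors (2 * m) \<alpha> \<beta> \<delta>" for \<eta> \<eta>'
  proof -
    have "((\<lambda>y. \<Sum>j=1..2*m. (-1) ^ j * H (y + \<eta>' j)) has_real_derivative
        (\<Sum>j=1..2*m. (-1) ^ j * F (x + \<eta>' j))) (at x)" for x
      by (intro DERIV_sum DERIV_cmult DERIV_shift[THEN iffD1] H)
    then show ?thesis
      unfolding union_integral_shift[OF F that(2) \<open>0 \<le> \<delta>\<close>]
      by (subst union_integral_antiderivative[OF _ that(1) \<open>0 \<le> \<delta>\<close>]) (auto simp: sum_distrib_left mult.assoc)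
  qed
  show ?thesis
    unfolding eq[OF \<theta> \<theta>'] eq[OF \<theta>' \<theta>] by (subst sum.swap) (simp add: mult_ac add.commute)
qed

section \<open>Variation of the endpoints\<close>

text \<open>For \<open>h = (\<theta> - \<theta>') / N\<close> this is the difference quotient of the integral of \<open>f\<close> over the interval union,
  and for \<open>\<theta> = \<theta>'\<close> it is the directional derivative; both cases enter the compactness argument.\<close>

definition endpoint_variation ::
    "nat \<Rightarrow> (nat \<Rightarrow> real) \<Rightarrow> (nat \<Rightarrow> real) \<Rightarrow> (nat \<Rightarrow> real) \<Rightarrow> (real \<Rightarrow> real) \<Rightarrow> real" where
  "endpoint_variation n \<theta> \<theta>' h f =
    (\<Sum>i=1..n. (-1) ^ i * h i * integral {0..1} (\<lambda>s. f (\<theta>' i + s * (\<theta> i - \<theta>' i))))"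

text \<open>The fundamental theorem of calculus on each segment from \<open>\<theta>' i\<close> to
  \<open>\<theta> i\<close>. Parametrising by \<open>{0..1}\<close> keeps the orientation and makes
  sense for a segment of length zero.\<close>

lemma union_integral_diff_eq_variation:
  assumes f: "continuous_on UNIV f" and "0 \<le> \<delta>"
    and \<theta>: "\<theta> \<in> gap_vectors (2 * m) \<alpha> \<beta> \<delta>" and \<theta>': "\<theta>' \<in> gap_vectors (2 * m) \<alpha> \<beta> \<delta>"
  shows "union_integral m \<theta> f - union_integral m \<theta>' f
    = endpoint_variation (2 * m) \<theta> \<theta>' (\<lambda>i. \<theta> i - \<theta>' i) f"
proof -
  obtain F where F: "\<And>x. (F has_real_derivative f x) (at x)"
    using antiderivative_exists[OF f] by blast
  have "(q - p) * integral {0..1} (\<lambda>s. f (p + s * (q - p))) = F q - F p" for p q :: real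
  proof -
    have "integral {0..1} (\<lambda>s. (q - p) * f (p + s * (q - p))) = F (p + 1 * (q - p)) - F (p + 0 * (q - p))"
    proof (rule integral_antiderivative)
      have "((\<lambda>s. p + s * (q - p)) has_real_derivative q - p) (at s)" for s
        by (auto intro!: derivative_eq_intros)
      from DERIV_chain2[OF F this]
      show "((\<lambda>s. F (p + s * (q - p))) has_real_derivative (q - p) * f (p + s * (q - p))) (at s)" for s
        by (simp add: mult.commute)
    qed simp
    then show ?thesis by simp
  qed
  then show ?thesis
    unfolding endpoint_variation_def union_integral_antiderivative[OF F \<theta> \<open>0 \<le> \<delta>\<close>]
      union_integral_antiderivative[OF F \<theta>' \<open>0 \<le> \<delta>\<close>] sum_subtractf[symmetric]
    by (intro sum.cong) (simp_all add: mult.assoc right_diff_distrib[symmetric])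
qed

lemma segment_in_interval:
  fixes p q s :: real
  assumes "p \<in> {\<alpha>..\<beta>}" "q \<in> {\<alpha>..\<beta>}" "s \<in> {0..1}"
  shows "p + s * (q - p) \<in> {\<alpha>..\<beta>}"
proof -
  have "p + s * (q - p) = (1 - s) *\<^sub>R p + s *\<^sub>R q" by (simp add: algebra_simps)
  also have "\<dots> \<in> {\<alpha>..\<beta>}"
    using assms by (intro convexD_alt) (auto intro: convex_real_interval)
  finally show ?thesis .
qed

lemma continuous_on_segment:
  fixes p q :: real
  assumes "continuous_on UNIV (f :: real \<Rightarrow> real)"
  shows "continuous_on S (\<lambda>s. f (p + s * (q - p)))"
  by (intro continuous_on_compose2[OF assms] continuous_intros) auto

lemma endpoint_variation_add:
  assumes "continuous_on UNIV f" "continuous_on UNIV g"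
  shows "endpoint_variation n \<theta> \<theta>' h (\<lambda>x. f x + g x)
    = endpoint_variation n \<theta> \<theta>' h f + endpoint_variation n \<theta> \<theta>' h g"
  unfolding endpoint_variation_def sum.distrib[symmetric]
  by (intro sum.cong refl)
    (subst Henstock_Kurzweil_Integration.integral_add,
      (rule integrable_continuous_interval continuous_on_segment assms)+, simp add: distrib_left)

lemma endpoint_variation_scale:
  "endpoint_variation n \<theta> \<theta>' h (\<lambda>x. c * f x) = c * endpoint_variation n \<theta> \<theta>' h f"
  unfolding endpoint_variation_def by (simp add: sum_distrib_left mult_ac)

lemma endpoint_variation_scale_direction:
  "endpoint_variation n \<theta> \<theta>' (\<lambda>i. c * h i) f = c * endpoint_variation n \<theta> \<theta>' h f"
  unfolding endpoint_variation_def by (simp add: sum_distrib_left mult_ac)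

lemma endpoint_variation_bound:
  assumes \<theta>: "\<theta> \<in> gap_vectors n \<alpha> \<beta> \<delta>" and \<theta>': "\<theta>' \<in> gap_vectors n \<alpha> \<beta> \<delta>" and "0 \<le> \<delta>"
    and f: "continuous_on UNIV f" "\<And>x. x \<in> {\<alpha>..\<beta>} \<Longrightarrow> \<bar>f x\<bar> \<le> e"
  shows "\<bar>endpoint_variation n \<theta> \<theta>' h f\<bar> \<le> (\<Sum>i=1..n. \<bar>h i\<bar>) * e"
proof -
  have "\<bar>integral {0..1} (\<lambda>s. f (\<theta>' i + s * (\<theta> i - \<theta>' i)))\<bar> \<le> e" if "i \<in> {1..n}" for i
  proof -
    have "norm (integral {0..1} (\<lambda>s. f (\<theta>' i + s * (\<theta> i - \<theta>' i)))) \<le> e * (1 - 0)"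
    proof (rule integral_bound)
      fix s :: real assume "s \<in> {0..1}"
      then have "\<theta>' i + s * (\<theta> i - \<theta>' i) \<in> {\<alpha>..\<beta>}"
        by (intro segment_in_interval gap_vectors_range[OF \<theta> \<open>0 \<le> \<delta>\<close> that]
            gap_vectors_range[OF \<theta>' \<open>0 \<le> \<delta>\<close> that])
      then show "norm (f (\<theta>' i + s * (\<theta> i - \<theta>' i))) \<le> e" using f(2) by simp
    qed (auto intro: continuous_on_segment f)
    then show ?thesis by simp
  qed
  then have "\<bar>endpoint_variation n \<theta> \<theta>' h f\<bar> \<le> (\<Sum>i=1..n. \<bar>h i\<bar> * e)"
    unfolding endpoint_variation_def
    by (intro order_trans[OF sum_abs] sum_mono) (auto simp: abs_mult intro!: mult_left_mono)
  then show ?thesis by (simp add: sum_distrib_right)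
qed

section \<open>Convolution of the variation with the sum of the two interval measures\<close>

definition kernel_variation ::
    "nat \<Rightarrow> (nat \<Rightarrow> real) \<Rightarrow> (nat \<Rightarrow> real) \<Rightarrow> (nat \<Rightarrow> real) \<Rightarrow> (real \<Rightarrow> real) \<Rightarrow> real" where
  "kernel_variation m \<theta> \<theta>' h f = endpoint_variation (2 * m) \<theta> \<theta>' h
    (\<lambda>y. union_integral m \<theta> (\<lambda>v. f (y + v)) + union_integral m \<theta>' (\<lambda>v. f (y + v)))"

lemma continuous_on_shift:
  assumes "continuous_on UNIV (f :: real \<Rightarrow> real)"
  shows "continuous_on S (\<lambda>v. f (y + v))"
  by (intro continuous_on_compose2[OF assms] continuous_intros) auto

text \<open>Both \<open>y\<close> and \<open>v\<close> range over
  \<open>{\<alpha>..\<beta>}\<close>, so \<open>f\<close> is evaluated only on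
  \<open>{2 * \<alpha>..2 * \<beta>}\<close>. Each of the \<open>m\<close> intervals has length at
  most \<open>\<beta>\<close>, and there are two unions; this gives the factor
  \<open>2 * (real m * \<beta>)\<close>.\<close>

lemma bounded_functional_kernel_variation:
  assumes \<theta>: "\<theta> \<in> gap_vectors (2 * m) \<alpha> \<beta> \<delta>" and \<theta>': "\<theta>' \<in> gap_vectors (2 * m) \<alpha> \<beta> \<delta>"
    and "0 \<le> \<delta>" "0 \<le> \<alpha>"
  shows "bounded_functional (kernel_variation m \<theta> \<theta>' h) (2 * \<alpha>) (2 * \<beta>)
    ((\<Sum>i=1..2 * m. \<bar>h i\<bar>) * (2 * (real m * \<beta>)))"
proof
  note cont = continuous_on_union_integral_shift[OF _ \<theta> \<open>0 \<le> \<delta>\<close>]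
    continuous_on_union_integral_shift[OF _ \<theta>' \<open>0 \<le> \<delta>\<close>]
  fix f :: "real \<Rightarrow> real" assume f: "continuous_on UNIV f"
  {
    fix g :: "real \<Rightarrow> real" assume g: "continuous_on UNIV g"
    show "kernel_variation m \<theta> \<theta>' h (\<lambda>s. f s + g s)
        = kernel_variation m \<theta> \<theta>' h f + kernel_variation m \<theta> \<theta>' h g"
      unfolding kernel_variation_def union_integral_add[OF f[THEN continuous_on_shift] g[THEN continuous_on_shift]]
      by (subst endpoint_variation_add[symmetric])
        (auto intro!: continuous_on_add cont f g simp: algebra_simps)
  next
    fix c :: real
    show "kernel_variation m \<theta> \<theta>' h (\<lambda>s. c * f s) = c * kernel_variation m \<theta> \<theta>' h f"
      unfolding kernel_variation_def union_integral_scale distrib_left[symmetric]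
      by (rule endpoint_variation_scale)
  next
    fix e :: real assume e: "\<And>s. s \<in> {2 * \<alpha>..2 * \<beta>} \<Longrightarrow> \<bar>f s\<bar> \<le> e"
    have bnd: "\<bar>union_integral m \<eta> (\<lambda>v. f (y + v))\<bar> \<le> real m * \<beta> * e"
      if "\<eta> \<in> gap_vectors (2 * m) \<alpha> \<beta> \<delta>" "y \<in> {\<alpha>..\<beta>}" for \<eta> y
      using that(2)
      by (intro union_integral_bound[OF that(1) \<open>0 \<le> \<delta>\<close> \<open>0 \<le> \<alpha>\<close>] continuous_on_shift f e) auto
    have "\<bar>union_integral m \<theta> (\<lambda>v. f (y + v)) + union_integral m \<theta>' (\<lambda>v. f (y + v))\<bar>
        \<le> 2 * (real m * \<beta>) * e" if "y \<in> {\<alpha>..\<beta>}" for y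
      using bnd[OF \<theta> that] bnd[OF \<theta>' that] by linarith
    then show "\<bar>kernel_variation m \<theta> \<theta>' h f\<bar>
        \<le> (\<Sum>i=1..2 * m. \<bar>h i\<bar>) * (2 * (real m * \<beta>)) * e"
      unfolding kernel_variation_def mult.assoc
      by (intro endpoint_variation_bound[OF \<theta> \<theta>' \<open>0 \<le> \<delta>\<close>] continuous_on_add cont f)
        (simp add: mult.assoc)
  }
qed

section \<open>Linear independence of the uniform measures on the segments\<close>

lemma integral_exp_segment_lower:
  fixes p q \<epsilon> :: real
  assumes "0 < \<epsilon>"
  obtains c where "0 < c"
    "\<And>t. 0 \<le> t \<Longrightarrow> c * exp (t * (max p q - \<epsilon>)) \<le> integral {0..1} (\<lambda>s. exp (t * (p + s * (q - p))))"
proof -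
  \<comment> \<open>A parameter interval of length \<open>c\<close> moves the point by at most
    \<open>\<epsilon>\<close>, and \<open>c\<close> does not depend on \<open>t\<close>. The added 1
    covers \<open>p = q\<close>; the minimum keeps \<open>c\<close> within the unit
    interval.\<close>
  define c where "c = min 1 (\<epsilon> / (\<bar>q - p\<bar> + 1))"
  have c: "0 < c" "c \<le> 1" using assms by (auto simp: c_def)
  have "c * \<bar>q - p\<bar> \<le> \<epsilon> / (\<bar>q - p\<bar> + 1) * (\<bar>q - p\<bar> + 1)"
    unfolding c_def using assms by (intro mult_mono) auto
  then have c\<epsilon>: "c * \<bar>q - p\<bar> \<le> \<epsilon>" by simp
  \<comment> \<open>The parameter interval is placed at the larger endpoint: at 1 if
    \<open>p \<le> q\<close>, otherwise at 0.\<close>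
  obtain x where x: "{x..x + c} \<subseteq> {0..1}"
    "\<And>s. s \<in> {x..x + c} \<Longrightarrow> max p q - \<epsilon> \<le> p + s * (q - p)"
  proof (cases "p \<le> q")
    case True
    have "q - \<epsilon> \<le> p + s * (q - p)" if "s \<in> {1 - c..1}" for s
    proof -
      have "(1 - s) * (q - p) \<le> c * (q - p)" using that True by (intro mult_right_mono) auto
      then show ?thesis using c\<epsilon> True by (simp add: algebra_simps)
    qed
    then show ?thesis using that[of "1 - c"] c True by (simp add: max_def)
  next
    case False
    have "p - \<epsilon> \<le> p + s * (q - p)" if "s \<in> {0..c}" for s
    proof -
      have "s * (p - q) \<le> c * (p - q)" using that False by (intro mult_right_mono) auto
      then show ?thesis using c\<epsilon> False by (simp add: algebra_simps)
    qed
    then show ?thesis using that[of 0] c False by (simp add: max_def)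
  qed
  have "c * exp (t * (max p q - \<epsilon>)) \<le> integral {0..1} (\<lambda>s. exp (t * (p + s * (q - p))))"
    if "0 \<le> t" for t
  proof -
    let ?g = "\<lambda>s. exp (t * (p + s * (q - p)))"
    have int: "?g integrable_on {a..b}" for a b
      by (intro integrable_continuous_interval continuous_intros)
    have "c * exp (t * (max p q - \<epsilon>)) = integral {x..x + c} (\<lambda>s. exp (t * (max p q - \<epsilon>)))"
      using c by simp
    also have "\<dots> \<le> integral {x..x + c} ?g"
      using x(2) that by (intro integral_le int) (auto intro!: mult_left_mono)
    also have "\<dots> \<le> integral {0..1} ?g"
      by (intro integral_subset_le x int) auto
    finally show ?thesis .
  qed
  then show ?thesis using that c by blast
qed

text \<open>The intervals between \<open>\<theta> i\<close> and \<open>\<theta>' i\<close> have right endpoints increasing in \<open>i\<close> in steps of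
  at least \<open>\<delta>\<close>, so for large \<open>t\<close> the exponential integral of the last one with \<open>h i \<noteq> 0\<close> dominates.\<close>

lemma exponential_variation_injective:
  assumes \<theta>: "\<theta> \<in> gap_vectors n \<alpha> \<beta> \<delta>" and \<theta>': "\<theta>' \<in> gap_vectors n \<alpha> \<beta> \<delta>" and "0 < \<delta>"
    and vanish: "\<And>t. endpoint_variation n \<theta> \<theta>' h (\<lambda>y. exp (t * y)) = 0"
    and "i \<in> {1..n}"
  shows "h i = 0"
proof (rule ccontr)
  assume "h i \<noteq> 0"
  define k where "k = Max {i \<in> {1..n}. h i \<noteq> 0}"
  have "k \<in> {i \<in> {1..n}. h i \<noteq> 0}"
    unfolding k_def using \<open>h i \<noteq> 0\<close> \<open>i \<in> {1..n}\<close> by (intro Max_in) auto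
  then have k: "k \<in> {1..n}" "h k \<noteq> 0" by auto
  have above: "h j = 0" if "j \<in> {1..n}" "k < j" for j
    using Max_ge[of "{i \<in> {1..n}. h i \<noteq> 0}" j] that unfolding k_def[symmetric] by auto
  define R where "R j = max (\<theta>' j) (\<theta> j)" for j
  define E where "E j t = integral {0..1} (\<lambda>s. exp (t * (\<theta>' j + s * (\<theta> j - \<theta>' j))))" for j t
  define H where "H = (\<Sum>j\<in>{1..<k}. \<bar>h j\<bar>)"
  \<comment> \<open>Losing only half of \<open>\<delta>\<close> here, against the full
    \<open>\<delta>\<close> in the upper bound for the earlier segments, leaves the growing factor
    \<open>exp (t * (\<delta> / 2))\<close>.\<close>
  obtain c where c: "0 < c" "\<And>t. 0 \<le> t \<Longrightarrow> c * exp (t * (R k - \<delta> / 2)) \<le> E k t"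
    using integral_exp_segment_lower[of "\<delta> / 2" "\<theta>' k" "\<theta> k"] \<open>0 < \<delta>\<close>
    unfolding R_def E_def by (metis half_gt_zero)
  have upper: "\<bar>E j t\<bar> \<le> exp (t * (R k - \<delta>))" if j: "j \<in> {1..<k}" and t: "0 \<le> t" for j t
  proof -
    have "\<theta> j + \<delta> \<le> \<theta> k" "\<theta>' j + \<delta> \<le> \<theta>' k"
      using j k \<open>0 < \<delta>\<close> by (auto intro!: gap_vectors_gap[OF \<theta>] gap_vectors_gap[OF \<theta>'])
    then have le: "\<theta>' j \<le> R k - \<delta>" "\<theta> j \<le> R k - \<delta>" by (auto simp: R_def)
    have "norm (E j t) \<le> exp (t * (R k - \<delta>)) * (1 - 0)"
      unfolding E_def
    proof (rule integral_bound)
      fix s :: real assume s: "s \<in> {0..1}"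
      have "\<theta>' j + s * (\<theta> j - \<theta>' j) \<in> {min (\<theta>' j) (\<theta> j)..R k - \<delta>}"
        using le s by (intro segment_in_interval) auto
      then show "norm (exp (t * (\<theta>' j + s * (\<theta> j - \<theta>' j)))) \<le> exp (t * (R k - \<delta>))"
        using t by (auto intro!: mult_left_mono)
    qed (auto intro!: continuous_intros)
    then show ?thesis by simp
  qed
  have main: "\<bar>h k\<bar> * c * exp (t * (\<delta> / 2)) \<le> H" if t: "0 \<le> t" for t
  proof -
    have "0 = (\<Sum>j=1..n. (-1) ^ j * h j * E j t)"
      using vanish[of t] unfolding endpoint_variation_def E_def by simp
    also have "\<dots> = (\<Sum>j\<in>insert k {1..<k}. (-1) ^ j * h j * E j t)"
      using k above by (intro sum.mono_neutral_right) (auto simp: not_less)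
    also have "\<dots> = (-1) ^ k * h k * E k t + (\<Sum>j\<in>{1..<k}. (-1) ^ j * h j * E j t)" by simp
    finally have "\<bar>(-1) ^ k * h k * E k t\<bar> = \<bar>\<Sum>j\<in>{1..<k}. (-1) ^ j * h j * E j t\<bar>" by linarith
    also have "\<dots> \<le> (\<Sum>j\<in>{1..<k}. \<bar>h j\<bar> * exp (t * (R k - \<delta>)))"
      using upper t by (intro order_trans[OF sum_abs] sum_mono) (auto simp: abs_mult intro!: mult_left_mono)
    also have "\<dots> = H * exp (t * (R k - \<delta>))" by (simp add: H_def sum_distrib_right)
    finally have "\<bar>h k\<bar> * \<bar>E k t\<bar> \<le> H * exp (t * (R k - \<delta>))"
      by (simp add: abs_mult)
    then have "\<bar>h k\<bar> * E k t \<le> H * exp (t * (R k - \<delta>))"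
      by (rule order_trans[OF mult_left_mono[OF abs_ge_self abs_ge_zero]])
    then have "\<bar>h k\<bar> * (c * exp (t * (R k - \<delta> / 2))) \<le> H * exp (t * (R k - \<delta>))"
      using c(2)[OF t] by (meson abs_ge_zero mult_left_mono order_trans)
    also have "exp (t * (R k - \<delta> / 2)) = exp (t * (\<delta> / 2)) * exp (t * (R k - \<delta>))"
      by (simp add: exp_add[symmetric] algebra_simps)
    finally have "\<bar>h k\<bar> * c * exp (t * (\<delta> / 2)) * exp (t * (R k - \<delta>)) \<le> H * exp (t * (R k - \<delta>))"
      by (simp add: mult_ac)
    then show ?thesis by simp
  qed
  define b where "b = \<bar>h k\<bar> * c"
  have b: "0 < b" using k c by (simp add: b_def)
  have H: "0 \<le> H" unfolding H_def by (simp add: sum_nonneg)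
  \<comment> \<open>Chosen so that \<open>b * (1 + t * (\<delta> / 2))\<close> is exactly
    \<open>b + H\<close>; then \<open>1 + x \<le> exp x\<close> already contradicts
    \<open>main\<close>.\<close>
  define t where "t = 2 * H / (\<delta> * b)"
  have "0 \<le> t" using H b \<open>0 < \<delta>\<close> by (simp add: t_def)
  have "b + H = b * (1 + t * (\<delta> / 2))" using b \<open>0 < \<delta>\<close> by (simp add: t_def field_simps)
  also have "\<dots> \<le> b * exp (t * (\<delta> / 2))" using b by (intro mult_left_mono exp_ge_add_one_self) auto
  also have "\<dots> \<le> H" using main[OF \<open>0 \<le> t\<close>] by (simp add: b_def)
  finally show False using b by simp
qed

text \<open>The Laplace transform of a convolution is a product, because
  \<open>exp (t * (y + v))\<close> factors.\<close>

lemma kernel_variation_exp: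
  "kernel_variation m \<theta> \<theta>' h (\<lambda>s. exp (t * s))
    = (union_integral m \<theta> (\<lambda>v. exp (t * v)) + union_integral m \<theta>' (\<lambda>v. exp (t * v)))
      * endpoint_variation (2 * m) \<theta> \<theta>' h (\<lambda>y. exp (t * y))"
  unfolding kernel_variation_def distrib_left exp_add union_integral_scale
  by (subst endpoint_variation_scale[symmetric]) (simp add: algebra_simps)

lemma kernel_pos: "0 < r \<Longrightarrow> 0 < r\<^sup>2 + (s :: real)\<^sup>2"
  by (simp add: add_pos_nonneg)

lemma continuous_on_kernel: "0 < r \<Longrightarrow> continuous_on S (\<lambda>s :: real. 1 / (r\<^sup>2 + s\<^sup>2)\<^sup>2)"
  using kernel_pos[of r] by (intro continuous_intros) (auto simp: less_imp_neq[symmetric])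

text \<open>As \<open>\<theta> = \<theta>'\<close> is allowed, this gives injectivity of the map to
  \<open>G\<close> and of its linearisation in one statement.\<close>

lemma kernel_variation_injective:
  assumes \<theta>: "\<theta> \<in> gap_vectors (2 * m) \<alpha> \<beta> \<delta>" and \<theta>': "\<theta>' \<in> gap_vectors (2 * m) \<alpha> \<beta> \<delta>"
    and "0 < \<delta>" "0 \<le> \<alpha>" "1 \<le> m" "0 < r1" "r1 < r2"
    and vanish: "\<And>r. r \<in> {r1..r2} \<Longrightarrow> kernel_variation m \<theta> \<theta>' h (\<lambda>s. 1 / (r\<^sup>2 + s\<^sup>2)\<^sup>2) = 0"
    and "i \<in> {1..2 * m}"
  shows "h i = 0"
proof (rule exponential_variation_injective[OF \<theta> \<theta>' \<open>0 < \<delta>\<close> _ \<open>i \<in> _\<close>])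
  fix t :: real
  interpret bounded_functional "kernel_variation m \<theta> \<theta>' h" "2 * \<alpha>" "2 * \<beta>"
    "(\<Sum>i=1..2 * m. \<bar>h i\<bar>) * (2 * (real m * \<beta>))"
    using assms by (intro bounded_functional_kernel_variation[OF \<theta> \<theta>']) auto
  have "kernel_variation m \<theta> \<theta>' h (\<lambda>s. exp (t * s)) = 0"
    by (rule vanishes[of r1 r2]) (use assms in \<open>auto intro!: continuous_intros\<close>)
  moreover have pos: "0 < union_integral m \<eta> (\<lambda>v. exp (t * v))"
    if "\<eta> \<in> gap_vectors (2 * m) \<alpha> \<beta> \<delta>" for \<eta>
    using assms by (intro union_integral_pos[OF that] continuous_intros) auto
  ultimately show "endpoint_variation (2 * m) \<theta> \<theta>' h (\<lambda>y. exp (t * y)) = 0"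
    using pos[OF \<theta>] pos[OF \<theta>'] by (simp add: kernel_variation_exp)
qed

section \<open>Expressing \<open>G\<close> and its differences by the kernel variation\<close>

lemma G_eq_union_integral:
  assumes \<theta>: "\<theta> \<in> gap_vectors (2 * m) \<alpha> \<beta> \<delta>" and "0 < \<alpha>" "0 < \<delta>" "0 < r"
  shows "G (interval_measure_of m \<theta>) r
    = union_integral m \<theta> (\<lambda>y. union_integral m \<theta> (\<lambda>v. 1 / (r\<^sup>2 + (y + v)\<^sup>2)\<^sup>2))"
proof -
  let ?K = "\<lambda>s :: real. 1 / (r\<^sup>2 + s\<^sup>2)\<^sup>2"
  have K: "continuous_on UNIV ?K" by (rule continuous_on_kernel[OF \<open>0 < r\<close>])
  have "(LINT v:{0<..}|interval_measure_of m \<theta>. ?K (y + v)) = union_integral m \<theta> (\<lambda>v. ?K (y + v))" for y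
    by (rule LINT_interval_measure_of[OF \<theta> \<open>0 < \<alpha>\<close> \<open>0 < \<delta>\<close> continuous_on_shift[OF K]])
  then show ?thesis
    unfolding G_def
    using LINT_interval_measure_of[OF \<theta> \<open>0 < \<alpha>\<close> \<open>0 < \<delta>\<close> continuous_on_union_integral_shift[OF K \<theta>]] \<open>0 < \<delta>\<close>
    by simp
qed

text \<open>Uniform in \<open>r \<ge> r0\<close>, this makes the set under the supremum bounded
  above, so that the supremum dominates its members. The two integrations contribute
  \<open>real m * \<beta>\<close> each.\<close>

lemma G_bound:
  assumes \<theta>: "\<theta> \<in> gap_vectors (2 * m) \<alpha> \<beta> \<delta>" and "0 < \<alpha>" "0 < \<delta>" "0 < r0" "r0 \<le> r"
  shows "\<bar>G (interval_measure_of m \<theta>) r\<bar> \<le> real m * \<beta> * (real m * \<beta> * (1 / (r0\<^sup>2)\<^sup>2))"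
proof -
  let ?K = "\<lambda>s :: real. 1 / (r\<^sup>2 + s\<^sup>2)\<^sup>2"
  have r: "0 < r" using assms by simp
  have K: "continuous_on UNIV ?K" by (rule continuous_on_kernel[OF r])
  have "\<bar>?K s\<bar> \<le> 1 / (r0\<^sup>2)\<^sup>2" for s
  proof -
    have "r0\<^sup>2 \<le> r\<^sup>2" using assms by (intro power_mono) auto
    then have "(r0\<^sup>2)\<^sup>2 \<le> (r\<^sup>2 + s\<^sup>2)\<^sup>2" by (intro power_mono) (auto intro: add_increasing2)
    then show ?thesis using assms kernel_pos[OF r, of s] by (auto intro!: divide_left_mono)
  qed
  then show ?thesis
    unfolding G_eq_union_integral[OF \<theta> \<open>0 < \<alpha>\<close> \<open>0 < \<delta>\<close> r] using assms
    by (intro union_integral_bound[OF \<theta>] continuous_on_union_integral_shift[OF K \<theta>]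
        continuous_on_shift[OF K]) auto
qed

text \<open>For a symmetric bilinear form, \<open>B(x, x) - B(x', x') = B(x - x', x + x')\<close>;
  the symmetry is \<open>union_integral_swap\<close>.\<close>

lemma G_diff_eq_kernel_variation:
  assumes \<theta>: "\<theta> \<in> gap_vectors (2 * m) \<alpha> \<beta> \<delta>" and \<theta>': "\<theta>' \<in> gap_vectors (2 * m) \<alpha> \<beta> \<delta>"
    and "0 < \<alpha>" "0 < \<delta>" "0 < r"
  shows "G (interval_measure_of m \<theta>) r - G (interval_measure_of m \<theta>') r
    = kernel_variation m \<theta> \<theta>' (\<lambda>i. \<theta> i - \<theta>' i) (\<lambda>s. 1 / (r\<^sup>2 + s\<^sup>2)\<^sup>2)"
proof -
  let ?K = "\<lambda>s :: real. 1 / (r\<^sup>2 + s\<^sup>2)\<^sup>2"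
  let ?g = "\<lambda>\<eta> y. union_integral m \<eta> (\<lambda>v. ?K (y + v))"
  have \<delta>: "0 \<le> \<delta>" using \<open>0 < \<delta>\<close> by simp
  have K: "continuous_on UNIV ?K" by (rule continuous_on_kernel[OF \<open>0 < r\<close>])
  note cont = continuous_on_union_integral_shift[OF K \<theta> \<delta>] continuous_on_union_integral_shift[OF K \<theta>' \<delta>]
  have "kernel_variation m \<theta> \<theta>' (\<lambda>i. \<theta> i - \<theta>' i) ?K
      = union_integral m \<theta> (\<lambda>y. ?g \<theta> y + ?g \<theta>' y) - union_integral m \<theta>' (\<lambda>y. ?g \<theta> y + ?g \<theta>' y)"
    unfolding kernel_variation_def
    by (rule union_integral_diff_eq_variation[OF _ \<delta> \<theta> \<theta>', symmetric]) (intro continuous_on_add cont)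
  also have "\<dots> = union_integral m \<theta> (?g \<theta>) - union_integral m \<theta>' (?g \<theta>')"
    using union_integral_swap[OF K \<delta> \<theta> \<theta>'] by (simp add: union_integral_add[OF cont])
  finally show ?thesis
    using assms by (simp add: G_eq_union_integral)
qed

section \<open>Compactness and the stability estimate\<close>

text \<open>The inner integrals have limits that move with the parameters. An antiderivative turns
  them into finite sums of continuous terms, and only an integral over the fixed interval from 0 to
  1 remains.\<close>

lemma continuous_on_kernel_variation:
  assumes f: "continuous_on UNIV f" and "0 \<le> \<delta>" and Q: "Q \<subseteq> gap_vectors (2 * m) \<alpha> \<beta> \<delta>"
  shows "continuous_on (Q \<times> Q \<times> S) (\<lambda>(\<theta>, \<theta>', h). kernel_variation m \<theta> \<theta>' h f)"
proof -
  obtain F where F: "\<And>x. (F has_real_derivative f x) (at x)"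
    using antiderivative_exists[OF f] by blast
  note Fc = continuous_on_compose2[OF has_real_derivative_continuous_on[OF F]]
  have coord: "continuous_on A (\<lambda>x. fst (p x) i)" "continuous_on A (\<lambda>x. fst (snd (p x)) i)"
      "continuous_on A (\<lambda>x. snd (snd (p x)) i)"
    if "continuous_on A p" for i A and p :: "'x :: topological_space \<Rightarrow> (nat \<Rightarrow> real) \<times> (nat \<Rightarrow> real) \<times> (nat \<Rightarrow> real)"
    by (rule continuous_on_product_then_coordinatewise, intro continuous_on_fst continuous_on_snd that)+
  define I where "I i p s = (\<Sum>j=1..2 * m. (-1) ^ j * F (fst (snd p) i + s * (fst p i - fst (snd p) i) + fst p j))
      + (\<Sum>j=1..2 * m. (-1) ^ j * F (fst (snd p) i + s * (fst p i - fst (snd p) i) + fst (snd p) j))"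
    for i s and p :: "(nat \<Rightarrow> real) \<times> (nat \<Rightarrow> real) \<times> (nat \<Rightarrow> real)"
  have "continuous_on (Q \<times> Q \<times> S) (\<lambda>p. integral (cbox 0 1) (I i p))" for i
    by (rule integral_continuous_on_param)
      (auto simp: I_def split_beta intro!: continuous_on_add continuous_on_sum continuous_on_mult
        continuous_on_diff continuous_on_const Fc coord continuous_on_fst continuous_on_snd continuous_on_id)
  then have "continuous_on (Q \<times> Q \<times> S)
      (\<lambda>p. \<Sum>i=1..2 * m. (-1) ^ i * snd (snd p) i * integral (cbox 0 1) (I i p))"
    by (auto intro!: continuous_on_sum continuous_on_mult continuous_on_const coord continuous_on_id)
  moreover have "kernel_variation m (fst p) (fst (snd p)) (snd (snd p)) f
      = (\<Sum>i=1..2 * m. (-1) ^ i * snd (snd p) i * integral (cbox 0 1) (I i p))"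
    if "p \<in> Q \<times> Q \<times> S" for p
  proof -
    have \<theta>: "fst p \<in> gap_vectors (2 * m) \<alpha> \<beta> \<delta>" and \<theta>': "fst (snd p) \<in> gap_vectors (2 * m) \<alpha> \<beta> \<delta>"
      using that Q by auto
    show ?thesis
      unfolding kernel_variation_def endpoint_variation_def I_def box_real
        union_integral_shift[OF F \<theta> \<open>0 \<le> \<delta>\<close>] union_integral_shift[OF F \<theta>' \<open>0 \<le> \<delta>\<close>] ..
  qed
  ultimately have "continuous_on (Q \<times> Q \<times> S) (\<lambda>p. kernel_variation m (fst p) (fst (snd p)) (snd (snd p)) f)"
    by (subst continuous_on_cong[OF refl])
  then show ?thesis by (simp add: split_beta)
qed

text \<open>For each \<open>e > 0\<close> the points where some \<open>\<bar>f r p\<bar>\<close>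
  exceeds \<open>e\<close> form a relatively open set, and these sets cover \<open>P\<close>; a
  finite subcover yields the constant. Continuity is used in \<open>p\<close> for each single
  \<open>r\<close>.\<close>

lemma compact_uniformly_nonzero:
  fixes f :: "'r \<Rightarrow> 'p :: topological_space \<Rightarrow> real"
  assumes "compact P" and cont: "\<And>r. r \<in> R \<Longrightarrow> continuous_on P (f r)"
    and nonzero: "\<And>p. p \<in> P \<Longrightarrow> \<exists>r\<in>R. f r p \<noteq> 0"
  shows "\<exists>c>0. \<forall>p\<in>P. \<exists>r\<in>R. c \<le> \<bar>f r p\<bar>"
proof -
  let ?V = "\<lambda>e. \<Union>r\<in>R. P \<inter> (\<lambda>p. \<bar>f r p\<bar>) -` {e<..}"
  have "openin (top_of_set P) (?V e)" for e
    using cont by (intro openin_Union) (auto intro!: continuous_openin_preimage_gen continuous_intros)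
  then obtain W where W: "open (W e)" "?V e = P \<inter> W e" for e
    unfolding openin_open by metis
  have cover: "P \<subseteq> (\<Union>e\<in>{0<..}. W e)"
  proof
    fix p assume p: "p \<in> P"
    then obtain r where r: "r \<in> R" "f r p \<noteq> 0" using nonzero by blast
    then have "p \<in> ?V (\<bar>f r p\<bar> / 2)" using p by (intro UN_I[of r]) auto
    then have "p \<in> W (\<bar>f r p\<bar> / 2)" using W(2)[of "\<bar>f r p\<bar> / 2"] by blast
    then show "p \<in> (\<Union>e\<in>{0<..}. W e)" using r(2) by (intro UN_I[of "\<bar>f r p\<bar> / 2"]) auto
  qed
  obtain C where C: "C \<subseteq> {0<..}" "finite C" "P \<subseteq> (\<Union>e\<in>C. W e)"
    using compactE_image[OF \<open>compact P\<close> W(1) cover] by blast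
  \<comment> \<open>The inserted 1 keeps the minimum defined when the subcover is empty.\<close>
  define c where "c = Min (insert 1 C)"
  have "0 < c" using C by (auto simp: c_def)
  moreover have "\<exists>r\<in>R. c \<le> \<bar>f r p\<bar>" if p: "p \<in> P" for p
  proof -
    obtain e where e: "e \<in> C" "p \<in> W e" using C p by blast
    then have "p \<in> ?V e" using W(2)[of e] p by blast
    moreover have "c \<le> e" using C e by (auto simp: c_def)
    ultimately show ?thesis by force
  qed
  ultimately show ?thesis by blast
qed

text \<open>The unit sphere, extended by 0 so that it is compact in the product topology on all
  functions of the index.\<close>

definition unit_directions :: "nat \<Rightarrow> (nat \<Rightarrow> real) set" where
  "unit_directions n = {h. (\<forall>i. i \<notin> {1..n} \<longrightarrow> h i = 0) \<and> (\<Sum>i=1..n. (h i)\<^sup>2) = 1}"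

lemma compact_unit_directions: "compact (unit_directions n)"
proof -
  let ?S = "PiE UNIV (\<lambda>i. if i \<in> {1..n} then {-1..1} else {0 :: real})"
  let ?C = "{h :: nat \<Rightarrow> real. (\<Sum>i=1..n. (h i)\<^sup>2) = 1}"
  have "unit_directions n = ?S \<inter> ?C"
  proof (intro set_eqI iffI)
    fix h assume h: "h \<in> unit_directions n"
    have "h i \<in> {-1..1}" if "i \<in> {1..n}" for i
    proof -
      have "(h i)\<^sup>2 \<le> (\<Sum>i=1..n. (h i)\<^sup>2)" using that by (intro member_le_sum) auto
      then have "\<bar>h i\<bar> \<le> 1" using h by (simp add: unit_directions_def abs_square_le_1)
      then show ?thesis by auto
    qed
    then show "h \<in> ?S \<inter> ?C" using h by (auto simp: unit_directions_def)
  next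
    fix h assume h: "h \<in> ?S \<inter> ?C"
    have "h i = 0" if "i \<notin> {1..n}" for i
      using PiE_mem[of h UNIV _ i] h that by (auto simp only: split: if_splits)
    then show "h \<in> unit_directions n" using h by (auto simp: unit_directions_def)
  qed
  moreover have "compact ?S" by (intro compact_PiE_UNIV) auto
  moreover have "closed ?C"
    by (intro closed_Collect_eq continuous_on_sum continuous_on_power continuous_on_const
        continuous_on_product_coordinates)
  ultimately show ?thesis by (simp add: compact_Int_closed)
qed

theorem theorem1p5:
  fixes m :: nat and \<alpha> \<beta> \<delta> r\<^sub>1 r\<^sub>2 :: real
  assumes "m \<ge> 1"
    and "0 < \<alpha>" and "\<alpha> < \<beta>"
    and "\<delta> > 0"
    and "0 < r\<^sub>1" and "r\<^sub>1 < r\<^sub>2"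
    and "(2 * real m - 1) * \<delta> \<le> \<beta> - \<alpha>"
  shows "\<exists>C::real. \<forall>\<theta>\<in>Theta m \<alpha> \<beta> \<delta>. \<forall>\<theta>'\<in>Theta m \<alpha> \<beta> \<delta>.
           euclid_dist (2 * m) \<theta> \<theta>' \<le>
             C * (SUP r\<in>{r\<^sub>1..r\<^sub>2}.
                    \<bar>G (interval_measure_of m \<theta>) r - G (interval_measure_of m \<theta>') r\<bar>)"
proof -
  define Q where "Q = gap_vectors (2 * m) \<alpha> \<beta> \<delta>"
  let ?K = "\<lambda>r s :: real. 1 / (r\<^sup>2 + s\<^sup>2)\<^sup>2"
  \<comment> \<open>The diagonal \<open>\<theta> = \<theta>'\<close> with every unit direction
    belongs to this set, so the lower bound \<open>c\<close> does not degenerate as the two vectors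
    approach each other.\<close>
  let ?P = "Q \<times> Q \<times> unit_directions (2 * m)"
  let ?f = "\<lambda>r (\<theta>, \<theta>', h). kernel_variation m \<theta> \<theta>' h (?K r)"
  have \<delta>: "0 \<le> \<delta>" using \<open>0 < \<delta>\<close> by simp
  have comp: "compact ?P"
    unfolding Q_def by (intro compact_Times compact_gap_vectors compact_unit_directions \<delta>)
  have cont: "continuous_on ?P (?f r)" if "r \<in> {r\<^sub>1..r\<^sub>2}" for r
    unfolding Q_def using that \<open>0 < r\<^sub>1\<close>
    by (intro continuous_on_kernel_variation[OF _ \<delta> order_refl] continuous_on_kernel) auto
  have nonzero: "\<exists>r\<in>{r\<^sub>1..r\<^sub>2}. ?f r p \<noteq> 0" if "p \<in> ?P" for p
  proof (rule ccontr)
    assume zero: "\<not> (\<exists>r\<in>{r\<^sub>1..r\<^sub>2}. ?f r p \<noteq> 0)"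
    obtain \<theta> \<theta>' h where p: "p = (\<theta>, \<theta>', h)" "\<theta> \<in> Q" "\<theta>' \<in> Q" "h \<in> unit_directions (2 * m)"
      using \<open>p \<in> ?P\<close> by auto
    have "h i = 0" if "i \<in> {1..2 * m}" for i
      by (rule kernel_variation_injective[OF p(2,3)[unfolded Q_def], of r\<^sub>1 r\<^sub>2])
        (use zero p(1) assms that in auto)
    then show False using p(4) by (simp add: unit_directions_def)
  qed
  have "\<exists>c>0. \<forall>p\<in>?P. \<exists>r\<in>{r\<^sub>1..r\<^sub>2}. c \<le> \<bar>?f r p\<bar>"
    by (rule compact_uniformly_nonzero[OF comp cont nonzero])
  then obtain c where c: "0 < c" "\<forall>p\<in>?P. \<exists>r\<in>{r\<^sub>1..r\<^sub>2}. c \<le> \<bar>?f r p\<bar>"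
    by blast
  have "euclid_dist (2 * m) \<theta> \<theta>' \<le> 1 / c * (SUP r\<in>{r\<^sub>1..r\<^sub>2}.
      \<bar>G (interval_measure_of m \<theta>) r - G (interval_measure_of m \<theta>') r\<bar>)"
    if "\<theta> \<in> Theta m \<alpha> \<beta> \<delta>" "\<theta>' \<in> Theta m \<alpha> \<beta> \<delta>" for \<theta> \<theta>'
  proof -
    have \<theta>: "\<theta> \<in> gap_vectors (2 * m) \<alpha> \<beta> \<delta>" and \<theta>': "\<theta>' \<in> gap_vectors (2 * m) \<alpha> \<beta> \<delta>"
      using that Theta_subset_gap_vectors by blast+
    let ?D = "\<lambda>r. \<bar>G (interval_measure_of m \<theta>) r - G (interval_measure_of m \<theta>') r\<bar>"
    let ?b = "real m * \<beta> * (real m * \<beta> * (1 / (r\<^sub>1\<^sup>2)\<^sup>2))"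
    have "?D r \<le> ?b + ?b" if "r \<in> {r\<^sub>1..r\<^sub>2}" for r
    proof -
      have r: "r\<^sub>1 \<le> r" using that by simp
      show ?thesis
        by (rule order_trans[OF abs_triangle_ineq4 add_mono])
          (rule G_bound[OF \<theta> \<open>0 < \<alpha>\<close> \<open>0 < \<delta>\<close> \<open>0 < r\<^sub>1\<close> r]
            G_bound[OF \<theta>' \<open>0 < \<alpha>\<close> \<open>0 < \<delta>\<close> \<open>0 < r\<^sub>1\<close> r])+
    qed
    then have "bdd_above (?D ` {r\<^sub>1..r\<^sub>2})" by (intro bdd_aboveI2)
    then have SUP: "?D r \<le> (SUP r\<in>{r\<^sub>1..r\<^sub>2}. ?D r)" if "r \<in> {r\<^sub>1..r\<^sub>2}" for r
      using that by (intro cSUP_upper)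
    define N where "N = euclid_dist (2 * m) \<theta> \<theta>'"
    have "0 \<le> N" by (simp add: N_def euclid_dist_def L2_set_nonneg)
    have "N * c \<le> (SUP r\<in>{r\<^sub>1..r\<^sub>2}. ?D r)"
    proof (cases "N = 0")
      case True
      \<comment> \<open>The supremum is nonnegative, since it dominates the absolute value at
        \<open>r\<^sub>1\<close>.\<close>
      then show ?thesis using order_trans[OF abs_ge_zero SUP[of r\<^sub>1]] \<open>r\<^sub>1 < r\<^sub>2\<close> by simp
    next
      case False
      with \<open>0 \<le> N\<close> have N: "0 < N" by simp
      \<comment> \<open>Both vectors are \<open>undefined\<close> outside \<open>{1..2 * m}\<close>;
        the value 0 there is what \<open>unit_directions\<close> asks for.\<close>
      define h where "h i = (if i \<in> {1..2 * m} then (\<theta> i - \<theta>' i) / N else 0)" for i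
      have N2: "N\<^sup>2 = (\<Sum>i=1..2 * m. (\<theta> i - \<theta>' i)\<^sup>2)"
        by (simp add: N_def euclid_dist_def L2_set_def sum_nonneg)
      have "(\<Sum>i=1..2 * m. (h i)\<^sup>2) = (\<Sum>i=1..2 * m. (\<theta> i - \<theta>' i)\<^sup>2) / N\<^sup>2"
        by (simp add: h_def power_divide sum_divide_distrib)
      also have "\<dots> = 1" unfolding N2[symmetric] using N by simp
      finally have "h \<in> unit_directions (2 * m)" by (simp add: unit_directions_def h_def)
      then obtain r where r: "r \<in> {r\<^sub>1..r\<^sub>2}" "c \<le> \<bar>kernel_variation m \<theta> \<theta>' h (?K r)\<bar>"
        using bspec[OF c(2), of "(\<theta>, \<theta>', h)"] \<theta> \<theta>' by (auto simp: Q_def)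
      \<comment> \<open>The variation reads its direction only at indices in
        \<open>{1..2 * m}\<close>, where the two directions agree.\<close>
      have "kernel_variation m \<theta> \<theta>' (\<lambda>i. \<theta> i - \<theta>' i) (?K r) = kernel_variation m \<theta> \<theta>' (\<lambda>i. N * h i) (?K r)"
        unfolding kernel_variation_def endpoint_variation_def using N
        by (intro sum.cong) (auto simp: h_def)
      also have "\<dots> = N * kernel_variation m \<theta> \<theta>' h (?K r)"
        unfolding kernel_variation_def by (rule endpoint_variation_scale_direction)
      finally have "?D r = N * \<bar>kernel_variation m \<theta> \<theta>' h (?K r)\<bar>"
        using G_diff_eq_kernel_variation[OF \<theta> \<theta>' \<open>0 < \<alpha>\<close> \<open>0 < \<delta>\<close>, of r] r(1) \<open>0 < r\<^sub>1\<close> N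
        by (simp add: abs_mult)
      moreover have "N * c \<le> N * \<bar>kernel_variation m \<theta> \<theta>' h (?K r)\<bar>"
        using r(2) N by (intro mult_left_mono) auto
      ultimately show ?thesis using SUP[OF r(1)] by linarith
    qed
    then have "N \<le> (SUP r\<in>{r\<^sub>1..r\<^sub>2}. ?D r) / c" using c(1) by (simp only: pos_le_divide_eq)
    then show ?thesis by (simp add: N_def)
  qed
  then show ?thesis by blast
qed

end
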